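(* Let $(\Omega,\Omega^\Omega)$ be a sample space and let $\mathbf{QMS}$ be the category of quasi-measurable spaces and quasi-measurable maps with respect to $(\Omega,\Omega^\Omega)$. Then $\mathbf{QMS}$ is complete and cocomplete, i.e. it has all small limits and all small colimits.
   Context: A sample space $(\Omega,\Omega^\Omega)$ consists of a non-empty set $\Omega$ and a set $\Omega^\Omega$ of maps $\Omega\to\Omega$ that contains the identity map and all constant maps and is closed under composition. A quasi-measurable space (w.r.t. $(\Omega,\Omega^\Omega)$) is a pair $(\mathcal X,\mathcal X^\Omega)$ of a set $\mathcal X$ and a set $\mathcal X^\Omega$ of maps $X:\Omega\to\mathcal X$ (the admissible random variables) containing all constant maps and all compositions $X\circ\Phi$ with $X\in\mathcal X^\Omega$, $\Phi\in\Omega^\Omega$. (The empty set with $\emptyset^\Omega=\emptyset$ is a quasi-measurable space.) A quasi-measurable map $(\mathcal X,\mathcal X^\Omega)\to(\mathcal Y,\mathcal Y^\Omega)$ is a map $g:\mathcal X\to\mathcal Y$ with $g\circ X\in\mathcal Y^\Omega$ for all $X\in\mathcal X^\Omega$. *)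

theory Defs
  imports Main "HOL-Library.FuncSet"
begin

unbundle cardinal_syntax

text \<open>
  Maps between sets are represented as extensional functions (\<open>A \<rightarrow>\<^sub>E B\<close>), so that equality of
  maps is equality of functions; \<open>compose A g f\<close> is the composite \<open>g \<circ> f\<close> restricted to \<open>A\<close>.
\<close>

section \<open>Small sets\<close>

text \<open>
  Smallness is relative to a Grothendieck universe, represented by a type \<open>'u\<close> whose cardinality
  \<open>\<kappa>\<close> is a regular strong limit. The members of a Grothendieck universe \<open>U\<close> are exactly the subsets
  of \<open>U\<close> of cardinality less than that of \<open>U\<close>, which is what the predicate \<open>small\<close> says.
  Uncountability of \<open>\<kappa>\<close> is not required: if \<open>\<kappa>\<close> is uncountable it is strongly inaccessible, and
  otherwise the small sets are the finite ones (so for instance \<open>nat\<close> is a universe).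
\<close>

definition universe :: "'u itself \<Rightarrow> bool" where
  "universe _ \<longleftrightarrow>
     infinite (UNIV :: 'u set) \<and>
     regularCard |UNIV :: 'u set| \<and>
     (\<forall>A :: 'u set. |A| <o |UNIV :: 'u set| \<longrightarrow> |Pow A| <o |UNIV :: 'u set| )"

definition small :: "'u set \<Rightarrow> bool" where
  "small A \<longleftrightarrow> |A| <o |UNIV :: 'u set|"

section \<open>Categories, limits and colimits\<close>

record ('o, 'm) cat =
  Obj :: "'o set"
  Arr :: "'m set"
  Dom :: "'m \<Rightarrow> 'o"
  Cod :: "'m \<Rightarrow> 'o"
  Ident :: "'o \<Rightarrow> 'm"
  Comp :: "'m \<Rightarrow> 'm \<Rightarrow> 'm"  \<comment> \<open>\<open>Comp C g f\<close> is \<open>g\<close> after \<open>f\<close>, meaningful if \<open>Cod C f = Dom C g\<close>\<close>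

definition Hom :: "('o, 'm) cat \<Rightarrow> 'o \<Rightarrow> 'o \<Rightarrow> 'm set" where
  "Hom C a b = {f \<in> Arr C. Dom C f = a \<and> Cod C f = b}"

definition category :: "('o, 'm) cat \<Rightarrow> bool" where
  "category C \<longleftrightarrow>
     (\<forall>f \<in> Arr C. Dom C f \<in> Obj C \<and> Cod C f \<in> Obj C) \<and>
     (\<forall>a \<in> Obj C. Ident C a \<in> Hom C a a) \<and>
     (\<forall>a \<in> Obj C. \<forall>b \<in> Obj C. \<forall>c \<in> Obj C. \<forall>f \<in> Hom C a b. \<forall>g \<in> Hom C b c.
        Comp C g f \<in> Hom C a c) \<and>
     (\<forall>a \<in> Obj C. \<forall>b \<in> Obj C. \<forall>f \<in> Hom C a b.
        Comp C f (Ident C a) = f \<and> Comp C (Ident C b) f = f) \<and>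
     (\<forall>a \<in> Obj C. \<forall>b \<in> Obj C. \<forall>c \<in> Obj C. \<forall>d \<in> Obj C.
        \<forall>f \<in> Hom C a b. \<forall>g \<in> Hom C b c. \<forall>h \<in> Hom C c d.
          Comp C h (Comp C g f) = Comp C (Comp C h g) f)"

text \<open>
  The objects and arrows of a small category are taken from the universe itself. Any category, on
  whatever types, with fewer than \<open>\<kappa>\<close> objects and arrows is isomorphic to one of this form.
\<close>

definition small_category :: "('u, 'u) cat \<Rightarrow> bool" where
  "small_category J \<longleftrightarrow> category J \<and> small (Obj J) \<and> small (Arr J)"

record ('j, 'k, 'o, 'm) diagram =
  Fobj :: "'j \<Rightarrow> 'o"
  Farr :: "'k \<Rightarrow> 'm"

definition is_functor :: "('j, 'k) cat \<Rightarrow> ('o, 'm) cat \<Rightarrow> ('j, 'k, 'o, 'm) diagram \<Rightarrow> bool" where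
  "is_functor J C F \<longleftrightarrow>
     (\<forall>i \<in> Obj J. Fobj F i \<in> Obj C) \<and>
     (\<forall>i \<in> Obj J. \<forall>j \<in> Obj J. \<forall>f \<in> Hom J i j. Farr F f \<in> Hom C (Fobj F i) (Fobj F j)) \<and>
     (\<forall>i \<in> Obj J. Farr F (Ident J i) = Ident C (Fobj F i)) \<and>
     (\<forall>i \<in> Obj J. \<forall>j \<in> Obj J. \<forall>k \<in> Obj J. \<forall>f \<in> Hom J i j. \<forall>g \<in> Hom J j k.
        Farr F (Comp J g f) = Comp C (Farr F g) (Farr F f))"

definition is_cone ::
  "('j, 'k) cat \<Rightarrow> ('o, 'm) cat \<Rightarrow> ('j, 'k, 'o, 'm) diagram \<Rightarrow> 'o \<Rightarrow> ('j \<Rightarrow> 'm) \<Rightarrow> bool" where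
  "is_cone J C F a \<sigma> \<longleftrightarrow>
     a \<in> Obj C \<and>
     (\<forall>i \<in> Obj J. \<sigma> i \<in> Hom C a (Fobj F i)) \<and>
     (\<forall>i \<in> Obj J. \<forall>j \<in> Obj J. \<forall>f \<in> Hom J i j. Comp C (Farr F f) (\<sigma> i) = \<sigma> j)"

definition is_limit ::
  "('j, 'k) cat \<Rightarrow> ('o, 'm) cat \<Rightarrow> ('j, 'k, 'o, 'm) diagram \<Rightarrow> 'o \<Rightarrow> ('j \<Rightarrow> 'm) \<Rightarrow> bool" where
  "is_limit J C F a \<pi> \<longleftrightarrow>
     is_cone J C F a \<pi> \<and>
     (\<forall>b \<sigma>. is_cone J C F b \<sigma> \<longrightarrow>
        (\<exists>!u. u \<in> Hom C b a \<and> (\<forall>i \<in> Obj J. Comp C (\<pi> i) u = \<sigma> i)))"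

definition is_cocone ::
  "('j, 'k) cat \<Rightarrow> ('o, 'm) cat \<Rightarrow> ('j, 'k, 'o, 'm) diagram \<Rightarrow> 'o \<Rightarrow> ('j \<Rightarrow> 'm) \<Rightarrow> bool" where
  "is_cocone J C F a \<sigma> \<longleftrightarrow>
     a \<in> Obj C \<and>
     (\<forall>i \<in> Obj J. \<sigma> i \<in> Hom C (Fobj F i) a) \<and>
     (\<forall>i \<in> Obj J. \<forall>j \<in> Obj J. \<forall>f \<in> Hom J i j. Comp C (\<sigma> j) (Farr F f) = \<sigma> i)"

definition is_colimit ::
  "('j, 'k) cat \<Rightarrow> ('o, 'm) cat \<Rightarrow> ('j, 'k, 'o, 'm) diagram \<Rightarrow> 'o \<Rightarrow> ('j \<Rightarrow> 'm) \<Rightarrow> bool" where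
  "is_colimit J C F a \<iota> \<longleftrightarrow>
     is_cocone J C F a \<iota> \<and>
     (\<forall>b \<sigma>. is_cocone J C F b \<sigma> \<longrightarrow>
        (\<exists>!u. u \<in> Hom C a b \<and> (\<forall>i \<in> Obj J. Comp C u (\<iota> i) = \<sigma> i)))"

definition complete_category :: "'u itself \<Rightarrow> ('o, 'm) cat \<Rightarrow> bool" where
  "complete_category _ C \<longleftrightarrow>
     category C \<and>
     (\<forall>(J :: ('u, 'u) cat) F. small_category J \<and> is_functor J C F \<longrightarrow>
        (\<exists>a \<pi>. is_limit J C F a \<pi>))"

definition cocomplete_category :: "'u itself \<Rightarrow> ('o, 'm) cat \<Rightarrow> bool" where
  "cocomplete_category _ C \<longleftrightarrow>
     category C \<and>
     (\<forall>(J :: ('u, 'u) cat) F. small_category J \<and> is_functor J C F \<longrightarrow>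
        (\<exists>a \<iota>. is_colimit J C F a \<iota>))"

section \<open>Quasi-measurable spaces\<close>

definition sample_space :: "'w set \<Rightarrow> ('w \<Rightarrow> 'w) set \<Rightarrow> bool" where
  "sample_space \<Omega> M \<longleftrightarrow>
     \<Omega> \<noteq> {} \<and>
     M \<subseteq> \<Omega> \<rightarrow>\<^sub>E \<Omega> \<and>
     (\<lambda>\<omega>\<in>\<Omega>. \<omega>) \<in> M \<and>
     (\<forall>c \<in> \<Omega>. (\<lambda>\<omega>\<in>\<Omega>. c) \<in> M) \<and>
     (\<forall>\<Phi> \<in> M. \<forall>\<Psi> \<in> M. compose \<Omega> \<Phi> \<Psi> \<in> M)"

record ('w, 'a) qms =
  Carrier :: "'a set"
  RV :: "('w \<Rightarrow> 'a) set"  \<comment> \<open>the admissible random variables\<close>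

definition quasi_measurable_space ::
  "'w set \<Rightarrow> ('w \<Rightarrow> 'w) set \<Rightarrow> ('w, 'a) qms \<Rightarrow> bool" where
  "quasi_measurable_space \<Omega> M S \<longleftrightarrow>
     RV S \<subseteq> \<Omega> \<rightarrow>\<^sub>E Carrier S \<and>
     (\<forall>x \<in> Carrier S. (\<lambda>\<omega>\<in>\<Omega>. x) \<in> RV S) \<and>
     (\<forall>X \<in> RV S. \<forall>\<Phi> \<in> M. compose \<Omega> X \<Phi> \<in> RV S)"

definition quasi_measurable_map ::
  "'w set \<Rightarrow> ('w, 'a) qms \<Rightarrow> ('w, 'b) qms \<Rightarrow> ('a \<Rightarrow> 'b) \<Rightarrow> bool" where
  "quasi_measurable_map \<Omega> S T g \<longleftrightarrow>
     g \<in> Carrier S \<rightarrow>\<^sub>E Carrier T \<and>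
     (\<forall>X \<in> RV S. compose \<Omega> g X \<in> RV T)"

text \<open>
  An arrow is a triple (source, underlying map, target). The sample space may live on any type and
  need not be small, so only the underlying set of an object is required to be small; if \<open>\<Omega>\<close> is
  small, then so is the set of all maps from \<open>\<Omega>\<close> to a small set.
\<close>

definition QMS ::
  "'w set \<Rightarrow> ('w \<Rightarrow> 'w) set \<Rightarrow>
     (('w, 'u) qms, ('w, 'u) qms \<times> ('u \<Rightarrow> 'u) \<times> ('w, 'u) qms) cat" where
  "QMS \<Omega> M =
     (let objs = {S. quasi_measurable_space \<Omega> M S \<and> small (Carrier S)} in
      \<lparr> Obj = objs,
        Arr = {(S, g, T). S \<in> objs \<and> T \<in> objs \<and> quasi_measurable_map \<Omega> S T g},
        Dom = (\<lambda>(S, g, T). S),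
        Cod = (\<lambda>(S, g, T). T),
        Ident = (\<lambda>S. (S, (\<lambda>x\<in>Carrier S. x), S)),
        Comp = (\<lambda>(T, h, U) (S, g, T'). (S, compose (Carrier S) h g, U)) \<rparr>)"

end

theory Submission
  imports Defs
begin

text \<open>
  Both constructions lift those of sets. A limit is the set of compatible families with the initial
  structure: a map into it is an admissible random variable iff all its components are. A colimit
  is a quotient of the disjoint union, and its admissible random variables are those which factor
  through one of the injections. Two points of the disjoint union are identified iff every cocone
  identifies them, so no generated equivalence relation is needed. The only role of the universe
  is to bound cardinalities: regularity makes the disjoint union small, and the strong limit
  property makes the product small.
\<close>

section \<open>Cardinalities\<close>

text \<open>The carrier of an object must be a subset of \<open>'u\<close>, whereas limits and
  colimits naturally consist of families or pairs. The injection \<open>e\<close> transports such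
  sets into \<open>'u\<close> without changing their cardinality.\<close>

lemma small_code:
  fixes A :: "'b set"
  assumes "|A| <o |UNIV :: 'u set|"
  obtains e :: "'b \<Rightarrow> 'u" where "inj_on e A" and "small (e ` A)"
proof -
  obtain e :: "'b \<Rightarrow> 'u" where e: "inj_on e A"
    using card_of_ordLeq[of A "UNIV :: 'u set"] ordLess_imp_ordLeq[OF assms] by auto
  moreover have "small (e ` A)"
    unfolding small_def using card_of_image assms by (rule ordLeq_ordLess_trans)
  ultimately show thesis by (rule that)
qed

text \<open>An infinite regular cardinal is stable: a disjoint union of fewer than \<kappa> sets,
  each of cardinality below \<kappa>, again has cardinality below \<kappa>.\<close>

lemma card_of_Sigma_universe:
  fixes I :: "'u set" and C :: "'u \<Rightarrow> 'u set"
  assumes U: "universe TYPE('u)" and "small I" and "\<And>i. i \<in> I \<Longrightarrow> small (C i)"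
  shows "|Sigma I C| <o |UNIV :: 'u set|"
proof -
  have "stable |UNIV :: 'u set|"
    using U unfolding universe_def by (intro regularCard_stable card_of_Card_order) (auto simp: Field_card_of)
  then show ?thesis
    using assms(2,3) unfolding small_def by (rule stable_elim)
qed

text \<open>A family is determined by its graph, which is a subset of the disjoint union. The
  product therefore embeds into the power set of a set below \<kappa>, and the strong limit property
  applies. That property speaks of subsets of \<open>'u\<close>, so the pairs are first encoded by
  \<open>e\<close>.\<close>

lemma card_of_PiE_universe:
  fixes I :: "'u set" and C :: "'u \<Rightarrow> 'u set"
  assumes U: "universe TYPE('u)" and "small I" and "\<And>i. i \<in> I \<Longrightarrow> small (C i)"
  shows "|Pi\<^sub>E I C| <o |UNIV :: 'u set|"
proof -
  let ?graph = "\<lambda>x. {(i, x i) | i. i \<in> I}"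
  obtain e :: "'u \<times> 'u \<Rightarrow> 'u" where e: "inj_on e (Sigma I C)" "small (e ` Sigma I C)"
    using small_code[OF card_of_Sigma_universe[OF assms]] .
  have "inj_on ?graph (Pi\<^sub>E I C)"
  proof (rule inj_onI)
    fix x y assume xy: "x \<in> Pi\<^sub>E I C" "y \<in> Pi\<^sub>E I C" "?graph x = ?graph y"
    have "x i = y i" if "i \<in> I" for i
    proof -
      have "(i, x i) \<in> ?graph y" using xy(3) that by blast
      then show ?thesis by simp
    qed
    with xy(1,2) show "x = y" by (rule PiE_ext)
  qed
  moreover have graph: "?graph ` Pi\<^sub>E I C \<subseteq> Pow (Sigma I C)" by auto
  ultimately have "inj_on (\<lambda>x. e ` ?graph x) (Pi\<^sub>E I C)"
    using inj_on_image_Pow[OF e(1)] comp_inj_on[of ?graph "Pi\<^sub>E I C" "(`) e"]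
    by (simp add: comp_def inj_on_subset)
  moreover have "(\<lambda>x. e ` ?graph x) ` Pi\<^sub>E I C \<subseteq> Pow (e ` Sigma I C)"
    using graph by blast
  ultimately have "|Pi\<^sub>E I C| \<le>o |Pow (e ` Sigma I C)|"
    using card_of_ordLeq by blast
  moreover have "|Pow (e ` Sigma I C)| <o |UNIV :: 'u set|"
    using U e(2) unfolding universe_def small_def by blast
  ultimately show ?thesis by (rule ordLeq_ordLess_trans)
qed

section \<open>The category of quasi-measurable spaces\<close>

abbreviation arr_map :: "'s \<times> 'f \<times> 't \<Rightarrow> 'f" where
  "arr_map f \<equiv> fst (snd f)"

lemma Obj_QMS:
  "S \<in> Obj (QMS \<Omega> M) \<longleftrightarrow> quasi_measurable_space \<Omega> M S \<and> small (Carrier S)"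
  by (simp add: QMS_def Let_def)

lemma Hom_QMS:
  "f \<in> Hom (QMS \<Omega> M) S T \<longleftrightarrow>
     fst f = S \<and> snd (snd f) = T \<and> S \<in> Obj (QMS \<Omega> M) \<and> T \<in> Obj (QMS \<Omega> M) \<and>
     quasi_measurable_map \<Omega> S T (arr_map f)"
  by (cases f) (auto simp: Hom_def QMS_def Let_def)

lemma Comp_QMS: "Comp (QMS \<Omega> M) (T, h, U) (S, g, T') = (S, compose (Carrier S) h g, U)"
  by (simp add: QMS_def Let_def)

lemma Ident_QMS: "Ident (QMS \<Omega> M) S = (S, (\<lambda>x\<in>Carrier S. x), S)"
  by (simp add: QMS_def Let_def)

lemma Comp_Hom_QMS:
  assumes "f \<in> Hom (QMS \<Omega> M) S T" and "g \<in> Hom (QMS \<Omega> M) T U"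
  shows "Comp (QMS \<Omega> M) g f = (S, compose (Carrier S) (arr_map g) (arr_map f), U)"
  using assms by (cases f; cases g) (simp add: Hom_QMS Comp_QMS)

lemma compose_eq_iff:
  assumes "k \<in> extensional A"
  shows "compose A g f = k \<longleftrightarrow> (\<forall>x\<in>A. g (f x) = k x)"
  using assms by (auto simp: compose_def extensional_def fun_eq_iff)

text \<open>Sources and targets agree by typing, and both underlying maps are extensional, so a
  triangle commutes as soon as it does so pointwise on the carrier. All cone and cocone equations
  below are handled in this form.\<close>

lemma Comp_QMS_eq_iff:
  assumes f: "f \<in> Hom (QMS \<Omega> M) S T" and g: "g \<in> Hom (QMS \<Omega> M) T U"
    and k: "k \<in> Hom (QMS \<Omega> M) S U"
  shows "Comp (QMS \<Omega> M) g f = k \<longleftrightarrow> (\<forall>x\<in>Carrier S. arr_map g (arr_map f x) = arr_map k x)"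
proof -
  have "arr_map k \<in> extensional (Carrier S)"
    using k by (simp add: Hom_QMS quasi_measurable_map_def PiE_iff)
  from compose_eq_iff[OF this] show ?thesis
    using k unfolding Comp_Hom_QMS[OF f g] by (cases k) (auto simp: Hom_QMS)
qed

lemma Hom_QMS_in_Carrier:
  "f \<in> Hom (QMS \<Omega> M) S T \<Longrightarrow> x \<in> Carrier S \<Longrightarrow> arr_map f x \<in> Carrier T"
  by (auto simp: Hom_QMS quasi_measurable_map_def dest: PiE_mem)

lemma Hom_QMS_RV:
  "f \<in> Hom (QMS \<Omega> M) S T \<Longrightarrow> X \<in> RV S \<Longrightarrow> compose \<Omega> (arr_map f) X \<in> RV T"
  by (auto simp: Hom_QMS quasi_measurable_map_def)

lemma Hom_QMS_eqI:
  assumes f: "f \<in> Hom (QMS \<Omega> M) S T" and g: "g \<in> Hom (QMS \<Omega> M) S T"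
    and eq: "\<And>x. x \<in> Carrier S \<Longrightarrow> arr_map f x = arr_map g x"
  shows "f = g"
proof -
  have "arr_map f = arr_map g"
    using f g eq by (auto simp: Hom_QMS quasi_measurable_map_def intro: PiE_ext)
  with f g show ?thesis by (simp add: Hom_QMS prod_eq_iff)
qed

lemma RV_in_Carrier:
  "S \<in> Obj (QMS \<Omega> M) \<Longrightarrow> X \<in> RV S \<Longrightarrow> \<omega> \<in> \<Omega> \<Longrightarrow> X \<omega> \<in> Carrier S"
  by (auto simp: Obj_QMS quasi_measurable_space_def)

text \<open>An admissible \<open>X\<close> takes its values in \<open>Carrier S\<close>, so
  restricting the composite to that carrier is invisible after \<open>X\<close>. Associativity then
  lets \<open>g\<close> and \<open>h\<close> be applied to \<open>X\<close> one after the
  other.\<close>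

lemma quasi_measurable_map_compose:
  assumes S: "S \<in> Obj (QMS \<Omega> M)"
    and g: "quasi_measurable_map \<Omega> S T g" and h: "quasi_measurable_map \<Omega> T U h"
  shows "quasi_measurable_map \<Omega> S U (compose (Carrier S) h g)"
  unfolding quasi_measurable_map_def
proof (intro conjI ballI)
  show "compose (Carrier S) h g \<in> Carrier S \<rightarrow>\<^sub>E Carrier U"
    using g h by (auto simp: quasi_measurable_map_def compose_def)
  fix X assume X: "X \<in> RV S"
  have "X \<in> \<Omega> \<rightarrow> Carrier S" using RV_in_Carrier[OF S X] by blast
  then have "compose \<Omega> (compose (Carrier S) h g) X = compose \<Omega> h (compose \<Omega> g X)"
    by (rule compose_assoc[symmetric])
  then show "compose \<Omega> (compose (Carrier S) h g) X \<in> RV U"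
    using g h X by (simp add: quasi_measurable_map_def)
qed

lemma Comp_in_Hom_QMS:
  assumes f: "f \<in> Hom (QMS \<Omega> M) S T" and g: "g \<in> Hom (QMS \<Omega> M) T U"
  shows "Comp (QMS \<Omega> M) g f \<in> Hom (QMS \<Omega> M) S U"
  using f g quasi_measurable_map_compose[of S \<Omega> M T "arr_map f" U "arr_map g"]
  unfolding Comp_Hom_QMS[OF f g] by (simp add: Hom_QMS)

lemma Ident_in_Hom_QMS:
  assumes S: "S \<in> Obj (QMS \<Omega> M)"
  shows "Ident (QMS \<Omega> M) S \<in> Hom (QMS \<Omega> M) S S"
proof -
  have "compose \<Omega> (\<lambda>x\<in>Carrier S. x) X = X" if "X \<in> RV S" for X
    using S that by (intro Id_compose) (auto simp: Obj_QMS quasi_measurable_space_def PiE_iff)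
  then show ?thesis
    using S by (auto simp: Hom_QMS Ident_QMS quasi_measurable_map_def)
qed

lemma category_QMS: "category (QMS \<Omega> M)"
  unfolding category_def
proof (intro conjI ballI)
  fix f assume "f \<in> Arr (QMS \<Omega> M)"
  then show "Dom (QMS \<Omega> M) f \<in> Obj (QMS \<Omega> M)" "Cod (QMS \<Omega> M) f \<in> Obj (QMS \<Omega> M)"
    by (auto simp: QMS_def Let_def)
next
  fix S assume "S \<in> Obj (QMS \<Omega> M)"
  then show "Ident (QMS \<Omega> M) S \<in> Hom (QMS \<Omega> M) S S" by (rule Ident_in_Hom_QMS)
next
  fix S T U f g assume "f \<in> Hom (QMS \<Omega> M) S T" "g \<in> Hom (QMS \<Omega> M) T U"
  then show "Comp (QMS \<Omega> M) g f \<in> Hom (QMS \<Omega> M) S U" by (rule Comp_in_Hom_QMS)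
next
  fix S T f assume ST: "S \<in> Obj (QMS \<Omega> M)" "T \<in> Obj (QMS \<Omega> M)" and f: "f \<in> Hom (QMS \<Omega> M) S T"
  show "Comp (QMS \<Omega> M) f (Ident (QMS \<Omega> M) S) = f"
    using Comp_QMS_eq_iff[OF Ident_in_Hom_QMS[OF ST(1)] f f] by (simp add: Ident_QMS)
  show "Comp (QMS \<Omega> M) (Ident (QMS \<Omega> M) T) f = f"
    using Comp_QMS_eq_iff[OF f Ident_in_Hom_QMS[OF ST(2)] f] Hom_QMS_in_Carrier[OF f]
    by (simp add: Ident_QMS)
next
  fix S T U V f g h
  assume f: "f \<in> Hom (QMS \<Omega> M) S T" and g: "g \<in> Hom (QMS \<Omega> M) T U"
    and h: "h \<in> Hom (QMS \<Omega> M) U V"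
  note gf = Comp_in_Hom_QMS[OF f g] and hg = Comp_in_Hom_QMS[OF g h]
  show "Comp (QMS \<Omega> M) h (Comp (QMS \<Omega> M) g f) = Comp (QMS \<Omega> M) (Comp (QMS \<Omega> M) h g) f"
    unfolding Comp_QMS_eq_iff[OF gf h Comp_in_Hom_QMS[OF f hg]]
    unfolding Comp_Hom_QMS[OF f hg]
    using Hom_QMS_in_Carrier[OF f]
    by (simp add: Comp_Hom_QMS[OF f g] Comp_Hom_QMS[OF g h] compose_eq)
qed

section \<open>Limits\<close>

text \<open>The index category may live on any types: the size of the diagram enters through the
  bound \<open>card\<close>, which makes it possible to encode families as elements of
  \<open>'u\<close>.\<close>

lemma QMS_has_limit:
  fixes F :: "('j, 'k, ('w, 'u) qms, ('w, 'u) qms \<times> ('u \<Rightarrow> 'u) \<times> ('w, 'u) qms) diagram"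
  assumes M: "M \<subseteq> \<Omega> \<rightarrow>\<^sub>E \<Omega>" and F: "is_functor J (QMS \<Omega> M) F"
    and card: "|\<Pi>\<^sub>E i\<in>Obj J. Carrier (Fobj F i)| <o |UNIV :: 'u set|"
  shows "\<exists>a \<pi>. is_limit J (QMS \<Omega> M) F a \<pi>"
proof -
  let ?Q = "QMS \<Omega> M"
  have Fobj: "Fobj F i \<in> Obj ?Q" if "i \<in> Obj J" for i
    using F that by (simp add: is_functor_def)
  have Farr: "Farr F f \<in> Hom ?Q (Fobj F i) (Fobj F j)"
    if "i \<in> Obj J" "j \<in> Obj J" "f \<in> Hom J i j" for i j f
    using F that by (simp add: is_functor_def)
  \<comment> \<open>The limit of the underlying sets: the compatible families inside the
    product.\<close>
  define L where "L = {x \<in> \<Pi>\<^sub>E i\<in>Obj J. Carrier (Fobj F i).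
    \<forall>i\<in>Obj J. \<forall>j\<in>Obj J. \<forall>f\<in>Hom J i j. arr_map (Farr F f) (x i) = x j}"
  have "|L| <o |UNIV :: 'u set|"
    using card_of_mono1 card by (rule ordLeq_ordLess_trans) (auto simp: L_def)
  then obtain e :: "('j \<Rightarrow> 'u) \<Rightarrow> 'u" where inj: "inj_on e L" and small: "small (e ` L)"
    by (rule small_code)
  define d where "d = inv_into L e"
  have d_e: "d (e x) = x" if "x \<in> L" for x
    using inj that by (simp add: d_def)
  have d_L: "d k \<in> L" and e_d: "e (d k) = k" if "k \<in> e ` L" for k
    using that by (auto simp: d_def inv_into_into f_inv_into_f)
  \<comment> \<open>The projection to component \<open>i\<close>, read off after decoding a point
    into its family.\<close>
  define p where "p i = (\<lambda>k\<in>e ` L. d k i)" for i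
  \<comment> \<open>This is the initial structure for the projections \<open>p i\<close>. If
    \<open>Obj J\<close> is empty, the carrier is a single point and \<open>a\<close> is the
    terminal object.\<close>
  define a :: "('w, 'u) qms" where "a = \<lparr>Carrier = e ` L,
    RV = {X \<in> \<Omega> \<rightarrow>\<^sub>E e ` L. \<forall>i\<in>Obj J. compose \<Omega> (p i) X \<in> RV (Fobj F i)}\<rparr>"
  define \<pi> where "\<pi> i = (a, p i, Fobj F i)" for i
  have p_in: "p i k \<in> Carrier (Fobj F i)" if "k \<in> e ` L" "i \<in> Obj J" for i k
    using d_L[OF that(1)] that by (auto simp: p_def L_def)
  have a: "a \<in> Obj ?Q"
    unfolding Obj_QMS quasi_measurable_space_def
  proof (intro conjI ballI)
    show "RV a \<subseteq> \<Omega> \<rightarrow>\<^sub>E Carrier a" by (auto simp: a_def)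
    show "small (Carrier a)" using small by (simp add: a_def)
  next
    fix k assume k: "k \<in> Carrier a"
    have "compose \<Omega> (p i) (\<lambda>\<omega>\<in>\<Omega>. k) = (\<lambda>\<omega>\<in>\<Omega>. p i k)" for i
      by (auto simp: compose_def)
    then show "(\<lambda>\<omega>\<in>\<Omega>. k) \<in> RV a"
      using k p_in Fobj by (auto simp: a_def Obj_QMS quasi_measurable_space_def)
  next
    fix X \<Phi> assume X: "X \<in> RV a" and \<Phi>: "\<Phi> \<in> M"
    have \<Phi>': "\<Phi> \<in> \<Omega> \<rightarrow> \<Omega>" using \<Phi> M by auto
    have "compose \<Omega> (p i) (compose \<Omega> X \<Phi>) \<in> RV (Fobj F i)" if "i \<in> Obj J" for i
      using Fobj[OF that] X \<Phi> that unfolding compose_assoc[OF \<Phi>']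
      by (simp add: a_def Obj_QMS quasi_measurable_space_def)
    moreover have "compose \<Omega> X \<Phi> \<in> \<Omega> \<rightarrow>\<^sub>E e ` L"
      using X \<Phi>' by (force simp: a_def compose_def)
    ultimately show "compose \<Omega> X \<Phi> \<in> RV a" by (simp add: a_def)
  qed
  have \<pi>: "\<pi> i \<in> Hom ?Q a (Fobj F i)" if "i \<in> Obj J" for i
  proof -
    \<comment> \<open>Only the typing of \<open>p i\<close> needs an argument; that it preserves
      admissibility is built into \<open>RV a\<close>.\<close>
    have "p i \<in> e ` L \<rightarrow>\<^sub>E Carrier (Fobj F i)"
      using p_in that by (simp add: p_def)
    then show ?thesis
      using that a Fobj by (simp add: Hom_QMS \<pi>_def quasi_measurable_map_def a_def)
  qed
  have cone: "is_cone J ?Q F a \<pi>"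
    unfolding is_cone_def
  proof (intro conjI ballI)
    fix i j f assume ij: "i \<in> Obj J" "j \<in> Obj J" and f: "f \<in> Hom J i j"
    \<comment> \<open>A decoded point lies in \<open>L\<close>, and this equation is the
      compatibility condition defining \<open>L\<close>.\<close>
    show "Comp ?Q (Farr F f) (\<pi> i) = \<pi> j"
      using d_L ij f unfolding Comp_QMS_eq_iff[OF \<pi>[OF ij(1)] Farr[OF ij f] \<pi>[OF ij(2)]]
      by (auto simp: \<pi>_def p_def a_def L_def)
  qed (use a \<pi> in auto)
  have "\<exists>!u. u \<in> Hom ?Q b a \<and> (\<forall>i\<in>Obj J. Comp ?Q (\<pi> i) u = \<sigma> i)"
    if b\<sigma>: "is_cone J ?Q F b \<sigma>" for b \<sigma>
  proof -
    have b: "b \<in> Obj ?Q" and \<sigma>: "\<And>i. i \<in> Obj J \<Longrightarrow> \<sigma> i \<in> Hom ?Q b (Fobj F i)"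
      and comm: "\<And>i j f. i \<in> Obj J \<Longrightarrow> j \<in> Obj J \<Longrightarrow> f \<in> Hom J i j \<Longrightarrow>
        Comp ?Q (Farr F f) (\<sigma> i) = \<sigma> j"
      using b\<sigma> by (auto simp: is_cone_def)
    \<comment> \<open>The legs of the cone evaluated at \<open>x\<close> form a family; the cone
      equations say that it is compatible. The restriction to \<open>Obj J\<close> makes it
      extensional, hence a member of the product.\<close>
    define t where "t x = (\<lambda>i\<in>Obj J. arr_map (\<sigma> i) x)" for x
    have t: "t x \<in> L" if x: "x \<in> Carrier b" for x
    proof -
      have "arr_map (Farr F f) (arr_map (\<sigma> i) x) = arr_map (\<sigma> j) x"
        if "i \<in> Obj J" "j \<in> Obj J" "f \<in> Hom J i j" for i j f
        using comm[OF that] Comp_QMS_eq_iff[OF \<sigma> Farr \<sigma>] that x by blast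
      then show ?thesis
        using Hom_QMS_in_Carrier[OF \<sigma> x] by (auto simp: L_def t_def)
    qed
    define u where "u = (b, (\<lambda>x\<in>Carrier b. e (t x)), a)"
    have p_u: "p i (arr_map u x) = arr_map (\<sigma> i) x" if "i \<in> Obj J" "x \<in> Carrier b" for i x
      using that t by (simp add: u_def p_def d_e t_def)
    have u: "u \<in> Hom ?Q b a"
    proof -
      have "compose \<Omega> (arr_map u) X \<in> RV a" if X: "X \<in> RV b" for X
      proof -
        have X': "X \<in> \<Omega> \<rightarrow> Carrier b" using RV_in_Carrier[OF b X] by blast
        \<comment> \<open>By initiality, admissibility can be tested after each projection. There
          the mediating map becomes the leg \<open>\<sigma> i\<close>, which is already
          quasi-measurable.\<close>
        have "compose \<Omega> (p i) (compose \<Omega> (arr_map u) X) = compose \<Omega> (arr_map (\<sigma> i)) X"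
          if "i \<in> Obj J" for i
          using X' p_u[OF that] by (auto simp: compose_def Pi_iff intro!: restrict_ext)
        then show ?thesis
          using X' t Hom_QMS_RV[OF \<sigma> X] by (auto simp: a_def u_def compose_def Pi_iff)
      qed
      moreover have "arr_map u \<in> Carrier b \<rightarrow>\<^sub>E Carrier a"
        using t by (auto simp: u_def a_def)
      ultimately show ?thesis
        using a b by (simp add: Hom_QMS quasi_measurable_map_def u_def)
    qed
    show ?thesis
    proof (intro ex1I conjI ballI)
      show "u \<in> Hom ?Q b a" by (rule u)
      fix i assume i: "i \<in> Obj J"
      show "Comp ?Q (\<pi> i) u = \<sigma> i"
        unfolding Comp_QMS_eq_iff[OF u \<pi>[OF i] \<sigma>[OF i]] using p_u[OF i] by (simp add: \<pi>_def)
    next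
      fix v assume "v \<in> Hom ?Q b a \<and> (\<forall>i\<in>Obj J. Comp ?Q (\<pi> i) v = \<sigma> i)"
      then have v: "v \<in> Hom ?Q b a" and eq: "\<And>i. i \<in> Obj J \<Longrightarrow> Comp ?Q (\<pi> i) v = \<sigma> i" by auto
      show "v = u"
      proof (rule Hom_QMS_eqI[OF v u])
        fix x assume x: "x \<in> Carrier b"
        have vx: "arr_map v x \<in> e ` L"
          using Hom_QMS_in_Carrier[OF v x] by (simp add: a_def)
        \<comment> \<open>Uniqueness: the cone equations force every component of the decoded value.
          Both families are extensional on \<open>Obj J\<close>, so they agree, and encoding again
          gives the value of \<open>u\<close>.\<close>
        have "d (arr_map v x) i = t x i" if "i \<in> Obj J" for i
        proof -
          have "p i (arr_map v x) = arr_map (\<sigma> i) x"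
            using eq[OF that] Comp_QMS_eq_iff[OF v \<pi>[OF that] \<sigma>[OF that]] x
            by (simp add: \<pi>_def)
          then show ?thesis using vx that by (simp add: p_def t_def)
        qed
        then have "d (arr_map v x) = t x"
          using d_L[OF vx] t[OF x] by (auto simp: L_def intro: PiE_ext)
        then show "arr_map v x = arr_map u x"
          using e_d[OF vx] x by (simp add: u_def)
      qed
    qed
  qed
  with cone show ?thesis unfolding is_limit_def by blast
qed

section \<open>Colimits\<close>

text \<open>A bound on the disjoint union is enough, because the quotient is realised on chosen
  representatives rather than on equivalence classes.\<close>

lemma QMS_has_colimit:
  fixes F :: "('j, 'k, ('w, 'u) qms, ('w, 'u) qms \<times> ('u \<Rightarrow> 'u) \<times> ('w, 'u) qms) diagram"
  assumes M: "M \<subseteq> \<Omega> \<rightarrow>\<^sub>E \<Omega>" and F: "is_functor J (QMS \<Omega> M) F"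
    and card: "|SIGMA i:Obj J. Carrier (Fobj F i)| <o |UNIV :: 'u set|"
  shows "\<exists>a \<iota>. is_colimit J (QMS \<Omega> M) F a \<iota>"
proof -
  let ?Q = "QMS \<Omega> M"
  have Fobj: "Fobj F i \<in> Obj ?Q" if "i \<in> Obj J" for i
    using F that by (simp add: is_functor_def)
  have Farr: "Farr F f \<in> Hom ?Q (Fobj F i) (Fobj F j)"
    if "i \<in> Obj J" "j \<in> Obj J" "f \<in> Hom J i j" for i j f
    using F that by (simp add: is_functor_def)
  define D where "D = (SIGMA i:Obj J. Carrier (Fobj F i))"
  \<comment> \<open>Being a conjunction of equations, one for each cocone, \<open>r\<close> is
    automatically an equivalence relation, and every cocone respects it by definition.\<close>
  define r where "r z z' \<longleftrightarrow> (\<forall>b \<sigma>. is_cocone J ?Q F b \<sigma> \<longrightarrow>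
    arr_map (\<sigma> (fst z)) (snd z) = arr_map (\<sigma> (fst z')) (snd z'))" for z z'
  have D: "|D| <o |UNIV :: 'u set|"
    unfolding D_def by (rule card)
  then obtain e :: "'j \<times> 'u \<Rightarrow> 'u" where inj: "inj_on e D" and "small (e ` D)"
    by (rule small_code)
  \<comment> \<open>The choice depends on \<open>z\<close> only through the predicate
    \<open>r z\<close>, so related points receive the same representative. Thus \<open>q\<close>
    below is the quotient map, with values encoded in \<open>'u\<close>.\<close>
  define rep where "rep z = (SOME z'. z' \<in> D \<and> r z z')" for z
  have rep: "rep z \<in> D" "r z (rep z)" if "z \<in> D" for z
  proof -
    have "z \<in> D \<and> r z z" using that by (simp add: r_def)
    then have "rep z \<in> D \<and> r z (rep z)" unfolding rep_def by (rule someI)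
    then show "rep z \<in> D" "r z (rep z)" by auto
  qed
  define q where "q z = e (rep z)" for z
  have q_iff: "q z = q z' \<longleftrightarrow> r z z'" if "z \<in> D" "z' \<in> D" for z z'
  proof
    assume "q z = q z'"
    then have "rep z = rep z'"
      using inj_onD[OF inj _ rep(1)[OF that(1)] rep(1)[OF that(2)]] by (simp add: q_def)
    then show "r z z'" using rep(2)[OF that(1)] rep(2)[OF that(2)] by (simp add: r_def)
  next
    assume "r z z'"
    \<comment> \<open>Related points have equal classes as predicates; hence \<open>SOME\<close>
      picks the same element for both.\<close>
    then have "r z = r z'" by (simp add: r_def fun_eq_iff)
    then show "q z = q z'" by (simp add: q_def rep_def)
  qed
  have small: "small (q ` D)"
    unfolding small_def using card_of_image D by (rule ordLeq_ordLess_trans)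
  define \<iota>' where "\<iota>' i = (\<lambda>x\<in>Carrier (Fobj F i). q (i, x))" for i
  \<comment> \<open>This is the final structure for the injections. Constants are covered because
    every point comes from some component. If \<open>Obj J\<close> is empty, then \<open>a\<close>
    is the empty space, the initial object.\<close>
  define a :: "('w, 'u) qms" where "a = \<lparr>Carrier = q ` D,
    RV = {compose \<Omega> (\<iota>' i) X | i X. i \<in> Obj J \<and> X \<in> RV (Fobj F i)}\<rparr>"
  define \<iota> where "\<iota> i = (Fobj F i, \<iota>' i, a)" for i
  have \<iota>'_in: "\<iota>' i x \<in> q ` D" if "i \<in> Obj J" "x \<in> Carrier (Fobj F i)" for i x
    using that by (auto simp: \<iota>'_def D_def)
  have a: "a \<in> Obj ?Q"
    unfolding Obj_QMS quasi_measurable_space_def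
  proof (intro conjI ballI)
    show "small (Carrier a)" using small by (simp add: a_def)
    show "RV a \<subseteq> \<Omega> \<rightarrow>\<^sub>E Carrier a"
      using \<iota>'_in RV_in_Carrier[OF Fobj] by (auto simp: a_def compose_def)
  next
    fix k assume "k \<in> Carrier a"
    then obtain i x where i: "i \<in> Obj J" and x: "x \<in> Carrier (Fobj F i)" and k: "k = \<iota>' i x"
      by (auto simp: a_def D_def \<iota>'_def)
    have "(\<lambda>\<omega>\<in>\<Omega>. k) = compose \<Omega> (\<iota>' i) (\<lambda>\<omega>\<in>\<Omega>. x)"
      by (auto simp: compose_def k)
    moreover have "(\<lambda>\<omega>\<in>\<Omega>. x) \<in> RV (Fobj F i)"
      using Fobj[OF i] x by (simp add: Obj_QMS quasi_measurable_space_def)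
    ultimately show "(\<lambda>\<omega>\<in>\<Omega>. k) \<in> RV a" using i by (auto simp: a_def)
  next
    fix Y \<Phi> assume "Y \<in> RV a" and \<Phi>: "\<Phi> \<in> M"
    then obtain i X where i: "i \<in> Obj J" and X: "X \<in> RV (Fobj F i)" and Y: "Y = compose \<Omega> (\<iota>' i) X"
      by (auto simp: a_def)
    have "\<Phi> \<in> \<Omega> \<rightarrow> \<Omega>" using \<Phi> M by auto
    \<comment> \<open>Precomposition with \<Phi> acts on the factor \<open>X\<close> and so stays
      within the same component.\<close>
    then have "compose \<Omega> Y \<Phi> = compose \<Omega> (\<iota>' i) (compose \<Omega> X \<Phi>)"
      unfolding Y by (rule compose_assoc[symmetric])
    moreover have "compose \<Omega> X \<Phi> \<in> RV (Fobj F i)"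
      using Fobj[OF i] X \<Phi> by (simp add: Obj_QMS quasi_measurable_space_def)
    ultimately show "compose \<Omega> Y \<Phi> \<in> RV a" using i by (auto simp: a_def)
  qed
  have \<iota>: "\<iota> i \<in> Hom ?Q (Fobj F i) a" if "i \<in> Obj J" for i
  proof -
    have "\<iota>' i \<in> Carrier (Fobj F i) \<rightarrow>\<^sub>E q ` D"
      using that \<iota>'_in by (simp add: \<iota>'_def)
    then show ?thesis
      using that a Fobj by (auto simp: Hom_QMS \<iota>_def quasi_measurable_map_def a_def)
  qed
  have cocone: "is_cocone J ?Q F a \<iota>"
    unfolding is_cocone_def
  proof (intro conjI ballI)
    fix i j f assume ij: "i \<in> Obj J" "j \<in> Obj J" and f: "f \<in> Hom J i j"
    show "Comp ?Q (\<iota> j) (Farr F f) = \<iota> i"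
      unfolding Comp_QMS_eq_iff[OF Farr[OF ij f] \<iota>[OF ij(2)] \<iota>[OF ij(1)]]
    proof
      fix x assume x: "x \<in> Carrier (Fobj F i)"
      let ?y = "arr_map (Farr F f) x"
      have y: "?y \<in> Carrier (Fobj F j)" using Hom_QMS_in_Carrier[OF Farr[OF ij f] x] .
      \<comment> \<open>The cocone equation for \<open>f\<close> says that each cocone identifies
        \<open>x\<close> with its image under \<open>f\<close>, which is what \<open>r\<close>
        demands.\<close>
      have "arr_map (\<sigma> j) ?y = arr_map (\<sigma> i) x" if "is_cocone J ?Q F b \<sigma>" for b \<sigma>
      proof -
        have "\<sigma> i \<in> Hom ?Q (Fobj F i) b" "\<sigma> j \<in> Hom ?Q (Fobj F j) b"
          "Comp ?Q (\<sigma> j) (Farr F f) = \<sigma> i"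
          using that ij f by (auto simp: is_cocone_def)
        then show ?thesis using Comp_QMS_eq_iff[OF Farr[OF ij f]] x by blast
      qed
      then have "r (j, ?y) (i, x)" by (simp add: r_def)
      then have "q (j, ?y) = q (i, x)" using q_iff x y ij by (simp add: D_def)
      then show "arr_map (\<iota> j) ?y = arr_map (\<iota> i) x"
        using x y by (simp add: \<iota>_def \<iota>'_def)
    qed
  qed (use a \<iota> in auto)
  have "\<exists>!u. u \<in> Hom ?Q a b \<and> (\<forall>i\<in>Obj J. Comp ?Q u (\<iota> i) = \<sigma> i)"
    if b\<sigma>: "is_cocone J ?Q F b \<sigma>" for b \<sigma>
  proof -
    have b: "b \<in> Obj ?Q" and \<sigma>: "\<And>i. i \<in> Obj J \<Longrightarrow> \<sigma> i \<in> Hom ?Q (Fobj F i) b"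
      using b\<sigma> by (auto simp: is_cocone_def)
    define h where "h z = arr_map (\<sigma> (fst z)) (snd z)" for z
    \<comment> \<open>The value at \<open>k\<close> is computed from an arbitrary preimage under
      \<open>q\<close>; independence of that choice is shown next.\<close>
    define u where "u = (a, (\<lambda>k\<in>q ` D. h (inv_into D q k)), b)"
    have u_q: "arr_map u (q z) = h z" if z: "z \<in> D" for z
    proof -
      have "q (inv_into D q (q z)) = q z" "inv_into D q (q z) \<in> D"
        using z by (auto simp: f_inv_into_f inv_into_into)
      \<comment> \<open>The selected preimage may differ from \<open>z\<close>, but the two are
        related, and \<open>r\<close> includes the equation for the cocone \<sigma> at hand.\<close>
      then have "r (inv_into D q (q z)) z" using q_iff z by blast
      then show ?thesis using b\<sigma> z by (simp add: r_def h_def u_def)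
    qed
    have u_\<iota>: "arr_map u (\<iota>' i x) = arr_map (\<sigma> i) x"
      if "i \<in> Obj J" "x \<in> Carrier (Fobj F i)" for i x
      using u_q[of "(i, x)"] that by (simp add: D_def \<iota>'_def h_def)
    have u: "u \<in> Hom ?Q a b"
    proof -
      have "compose \<Omega> (arr_map u) Y \<in> RV b" if "Y \<in> RV a" for Y
      proof -
        obtain i X where i: "i \<in> Obj J" and X: "X \<in> RV (Fobj F i)"
          and Y: "Y = compose \<Omega> (\<iota>' i) X"
          using \<open>Y \<in> RV a\<close> by (auto simp: a_def)
        \<comment> \<open>An admissible \<open>Y\<close> factors through one injection, after which
          the mediating map becomes the leg \<open>\<sigma> i\<close>.\<close>
        have "compose \<Omega> (arr_map u) Y = compose \<Omega> (arr_map (\<sigma> i)) X"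
          using u_\<iota>[OF i RV_in_Carrier[OF Fobj[OF i] X]] by (auto simp: Y compose_def intro!: restrict_ext)
        then show ?thesis using Hom_QMS_RV[OF \<sigma>[OF i] X] by simp
      qed
      moreover have "arr_map u \<in> Carrier a \<rightarrow>\<^sub>E Carrier b"
      proof
        fix k assume "k \<in> Carrier a"
        then obtain z where z: "z \<in> D" "k = q z" by (auto simp: a_def)
        then show "arr_map u k \<in> Carrier b"
          using u_q[OF z(1)] Hom_QMS_in_Carrier[OF \<sigma>] by (auto simp: D_def h_def)
      qed (simp add: u_def a_def)
      ultimately show ?thesis
        using a b by (simp add: Hom_QMS quasi_measurable_map_def u_def)
    qed
    show ?thesis
    proof (intro ex1I conjI ballI)
      show "u \<in> Hom ?Q a b" by (rule u)
      fix i assume i: "i \<in> Obj J"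
      show "Comp ?Q u (\<iota> i) = \<sigma> i"
        unfolding Comp_QMS_eq_iff[OF \<iota>[OF i] u \<sigma>[OF i]] using u_\<iota>[OF i] by (simp add: \<iota>_def)
    next
      fix v assume "v \<in> Hom ?Q a b \<and> (\<forall>i\<in>Obj J. Comp ?Q v (\<iota> i) = \<sigma> i)"
      then have v: "v \<in> Hom ?Q a b" and eq: "\<And>i. i \<in> Obj J \<Longrightarrow> Comp ?Q v (\<iota> i) = \<sigma> i" by auto
      show "v = u"
      proof (rule Hom_QMS_eqI[OF v u])
        fix k assume "k \<in> Carrier a"
        then obtain i x where i: "i \<in> Obj J" and x: "x \<in> Carrier (Fobj F i)" and k: "k = \<iota>' i x"
          by (auto simp: a_def D_def \<iota>'_def)
        \<comment> \<open>Uniqueness: the injections are jointly surjective, so the cocone equations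
          determine \<open>v\<close> at every point.\<close>
        have "arr_map v k = arr_map (\<sigma> i) x"
          using eq[OF i] Comp_QMS_eq_iff[OF \<iota>[OF i] v \<sigma>[OF i]] x by (simp add: \<iota>_def k)
        then show "arr_map v k = arr_map u k" using u_\<iota>[OF i x] by (simp add: k)
      qed
    qed
  qed
  with cocone show ?thesis unfolding is_colimit_def by blast
qed

section \<open>Existence of all small limits and colimits\<close>

theorem theorem2p19:
  fixes \<Omega> :: "'w set" and M :: "('w \<Rightarrow> 'w) set"
  assumes "universe TYPE('u)"
    and "sample_space \<Omega> M"
  shows "complete_category TYPE('u)
           (QMS \<Omega> M :: (('w, 'u) qms, ('w, 'u) qms \<times> ('u \<Rightarrow> 'u) \<times> ('w, 'u) qms) cat)
       \<and> cocomplete_category TYPE('u)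
           (QMS \<Omega> M :: (('w, 'u) qms, ('w, 'u) qms \<times> ('u \<Rightarrow> 'u) \<times> ('w, 'u) qms) cat)"
proof -
  let ?Q = "QMS \<Omega> M :: (('w, 'u) qms, ('w, 'u) qms \<times> ('u \<Rightarrow> 'u) \<times> ('w, 'u) qms) cat"
  have M: "M \<subseteq> \<Omega> \<rightarrow>\<^sub>E \<Omega>" using assms(2) by (simp add: sample_space_def)
  have "(\<exists>a \<pi>. is_limit J ?Q F a \<pi>) \<and> (\<exists>a \<iota>. is_colimit J ?Q F a \<iota>)"
    if "small_category J" and F: "is_functor J ?Q F" for J :: "('u, 'u) cat" and F
  proof -
    have I: "small (Obj J)" using that(1) by (simp add: small_category_def)
    have C: "small (Carrier (Fobj F i))" if "i \<in> Obj J" for i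
      using F that by (simp add: is_functor_def Obj_QMS)
    show ?thesis
      using QMS_has_limit[OF M F card_of_PiE_universe[OF assms(1) I C]]
        QMS_has_colimit[OF M F card_of_Sigma_universe[OF assms(1) I C]] by blast
  qed
  then show ?thesis
    unfolding complete_category_def cocomplete_category_def using category_QMS by blast
qed

end
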